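(* Let $(V,\omega)$ be a symplectic real vector space of dimension $2n$ with a fixed basis, and let $X:V\to V$ be a polynomial map with $X(0)=0$. Then $X$ is an $\omega$-Hamiltonian vector field if and only if $dX_x\in\mathfrak{sp}_{\omega}(n;\mathbb{R})$ for all $x\in V$.
   Context: A symplectic vector space $(V,\omega)$ is a finite-dimensional real vector space $V$ (of even dimension $2n$) with an alternating non-degenerate bilinear form $\omega:V\times V\to\mathbb{R}$. A (not necessarily symplectic) basis of $V$ is fixed, vectors are identified with their coordinate columns, and $[\omega]\in\mathbb{M}_{2n}(\mathbb{R})$ is the (skew-symmetric, invertible) matrix of $\omega$ in this basis, so $\omega(\mathbf u,\mathbf v)=\mathbf u^T[\omega]\mathbf v$. A polynomial map $V\to V$ is one whose components in the fixed basis are polynomials in the coordinates. A vector field $X:V\to V$ is $\omega$-Hamiltonian if there is a smooth function $H:V\to\mathbb{R}$ such that $\omega(X(x),\cdot)=dH_x$ for all $x\in V$; equivalently $X(x)=([\omega]^{-1})^T\nabla H(x)$, where $\nabla H$ is the column of partial derivatives of $H$ in the fixed basis. $\mathfrak{sp}_{\omega}(n;\mathbb{R})=\{L\in\mathbb{M}_{2n}(\mathbb{R}): L^T[\omega]+[\omega]L=0\}$. The symbol $dX_x$ denotes the matrix, in the fixed basis, of the derivative of $X$ at $x$. *)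

theory Defs
  imports "HOL-Analysis.Analysis"
begin

text \<open>
  The vector space V is an arbitrary type of class \<^class>\<open>euclidean_space\<close>. The inner product
  of that class only supplies the (canonical) topology and derivatives of a finite-dimensional
  real vector space; the symplectic form and the fixed basis are unrelated to it.
\<close>

definition symplectic_form :: "('v::euclidean_space \<Rightarrow> 'v \<Rightarrow> real) \<Rightarrow> bool" where
  "symplectic_form \<omega> \<longleftrightarrow>
     bilinear \<omega> \<and> (\<forall>v. \<omega> v v = 0) \<and> (\<forall>u. (\<forall>v. \<omega> u v = 0) \<longrightarrow> u = 0)"

definition indexed_basis :: "('m::finite \<Rightarrow> 'v::euclidean_space) \<Rightarrow> bool" where
  "indexed_basis b \<longleftrightarrow> inj b \<and> independent (range b) \<and> span (range b) = UNIV"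

definition coords :: "('m::finite \<Rightarrow> 'v::euclidean_space) \<Rightarrow> 'v \<Rightarrow> real ^ 'm" where
  "coords b v = (\<chi> i. representation (range b) v (b i))"

definition form_matrix ::
    "('m::finite \<Rightarrow> 'v::euclidean_space) \<Rightarrow> ('v \<Rightarrow> 'v \<Rightarrow> real) \<Rightarrow> real ^ 'm ^ 'm" where
  "form_matrix b \<omega> = (\<chi> i j. \<omega> (b i) (b j))"

text \<open>Column \<open>j\<close> holds the coordinates of the image of the \<open>j\<close>-th basis vector.\<close>

definition endo_matrix ::
    "('m::finite \<Rightarrow> 'v::euclidean_space) \<Rightarrow> ('v \<Rightarrow> 'v) \<Rightarrow> real ^ 'm ^ 'm" where
  "endo_matrix b f = (\<chi> i j. coords b (f (b j)) $ i)"

definition sp_matrices ::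
    "('m::finite \<Rightarrow> 'v::euclidean_space) \<Rightarrow> ('v \<Rightarrow> 'v \<Rightarrow> real) \<Rightarrow> (real ^ 'm ^ 'm) set" where
  "sp_matrices b \<omega> = {L. transpose L ** form_matrix b \<omega> + form_matrix b \<omega> ** L = 0}"

text \<open>
  On \<open>real ^ 'm\<close> the functions satisfying \<^const>\<open>real_polynomial_function\<close> are exactly
  the polynomials in the coordinates.
\<close>

definition polynomial_map ::
    "('m::finite \<Rightarrow> 'v::euclidean_space) \<Rightarrow> ('v \<Rightarrow> 'v) \<Rightarrow> bool" where
  "polynomial_map b X \<longleftrightarrow>
     (\<forall>i. \<exists>P :: real ^ 'm \<Rightarrow> real. real_polynomial_function P \<and>
        (\<forall>x. coords b (X x) $ i = P (coords b x)))"

text \<open>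
  Class \<open>C^k\<close> on the whole space. In finite dimension, the derivative of \<open>f\<close> is of class \<open>C^k\<close>
  iff each directional derivative is.
\<close>

primrec C_class :: "nat \<Rightarrow> ('v::euclidean_space \<Rightarrow> real) \<Rightarrow> bool" where
  "C_class 0 f \<longleftrightarrow> continuous_on UNIV f"
| "C_class (Suc k) f \<longleftrightarrow>
     (\<forall>x. f differentiable (at x)) \<and> (\<forall>v. C_class k (\<lambda>x. frechet_derivative f (at x) v))"

definition smooth :: "('v::euclidean_space \<Rightarrow> real) \<Rightarrow> bool" where
  "smooth f \<longleftrightarrow> (\<forall>k. C_class k f)"

definition hamiltonian_vector_field ::
    "('v::euclidean_space \<Rightarrow> 'v \<Rightarrow> real) \<Rightarrow> ('v \<Rightarrow> 'v) \<Rightarrow> bool" where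
  "hamiltonian_vector_field \<omega> X \<longleftrightarrow>
     (\<exists>H :: 'v \<Rightarrow> real. smooth H \<and> (\<forall>x. (H has_derivative (\<lambda>v. \<omega> (X x) v)) (at x)))"

lemma coords_expansion:
  assumes "indexed_basis b"
  shows "(\<Sum>i\<in>UNIV. (coords b v $ i) *\<^sub>R b i) = v"
proof -
  have b: "inj b" "independent (range b)" "span (range b) = UNIV"
    using assms by (auto simp: indexed_basis_def)
  have "(\<Sum>i\<in>UNIV. (coords b v $ i) *\<^sub>R b i)
      = (\<Sum>w\<in>range b. representation (range b) v w *\<^sub>R w)"
    using b(1) by (simp add: sum.reindex coords_def)
  also have "\<dots> = v"
    using b by (intro real_vector.sum_representation_eq) auto
  finally show ?thesis .
qed

lemma form_coords:
  assumes "indexed_basis b" "bilinear \<omega>"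
  shows "\<omega> u v = coords b u \<bullet> (form_matrix b \<omega> *v coords b v)"
proof -
  have "\<omega> u v = \<omega> (\<Sum>i\<in>UNIV. (coords b u $ i) *\<^sub>R b i) (\<Sum>j\<in>UNIV. (coords b v $ j) *\<^sub>R b j)"
    by (simp add: coords_expansion assms)
  also have "\<dots> = (\<Sum>i\<in>UNIV. \<Sum>j\<in>UNIV. \<omega> ((coords b u $ i) *\<^sub>R b i) ((coords b v $ j) *\<^sub>R b j))"
    by (simp add: bilinear_sum[OF assms(2)] sum.cartesian_product)
  also have "\<dots> = coords b u \<bullet> (form_matrix b \<omega> *v coords b v)"
    by (simp add: bilinear_lmul[OF assms(2)] bilinear_rmul[OF assms(2)] inner_vec_def
        matrix_vector_mult_def form_matrix_def sum_distrib_left mult.assoc mult.left_commute)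
       (simp add: mult.commute)
  finally show ?thesis .
qed

end

theory Submission
  imports Defs
begin

text \<open>
  The condition on \<open>dX\<^sub>x\<close> says that \<open>D x u v = \<omega> (dX\<^sub>x u) v\<close> is symmetric in \<open>u\<close> and \<open>v\<close>,
  that is, the polynomial 1-form \<open>A x v = \<omega> (X x) v\<close> is closed. A differential is closed because
  second derivatives commute; conversely a closed 1-form has the potential
  \<open>H x = \<integral>\<^sub>0\<^sup>1 A (t x) x dt\<close>, which is smooth because its directional derivatives \<open>A x v\<close> are
  polynomials.
\<close>

section \<open>Symmetry of second derivatives\<close>

text \<open>Two applications of the mean value theorem, first along \<open>v\<close> and then along
  \<open>u\<close>, collapse the second difference over the parallelogram spanned by
  \<open>s *\<^sub>R u\<close> and \<open>s *\<^sub>R v\<close> to a single value of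
  \<open>D\<close>.\<close>

lemma second_difference_mvt:
  fixes H :: "'a::real_normed_vector \<Rightarrow> real"
  assumes H: "\<And>x. (H has_derivative A x) (at x)"
    and A: "\<And>x v. ((\<lambda>x. A x v) has_derivative (\<lambda>u. D x u v)) (at x)"
    and s: "s > 0"
  obtains a b where "0 < a" "a < s" "0 < b" "b < s"
    "H (x + s *\<^sub>R u + s *\<^sub>R v) - H (x + s *\<^sub>R u) - H (x + s *\<^sub>R v) + H x
      = s * s * D (x + a *\<^sub>R u + b *\<^sub>R v) u v"
proof -
  have Ascale: "A y (c *\<^sub>R w) = c * A y w" for y c w
    using linear_cmul[OF has_derivative_linear[OF H]] by simp
  have Dscale: "D y (c *\<^sub>R w) z = c * D y w z" for y c w z
    using linear_cmul[OF has_derivative_linear[OF A]] by simp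
  have dH: "((\<lambda>t. H (y + t *\<^sub>R v)) has_derivative (\<lambda>h. h * A (y + t *\<^sub>R v) v)) (at t)" for y t
  proof -
    have "((\<lambda>t. H (y + t *\<^sub>R v)) has_derivative (\<lambda>h. A (y + t *\<^sub>R v) (h *\<^sub>R v))) (at t)"
      by (rule has_derivative_compose[OF _ H]) (auto intro!: derivative_eq_intros)
    then show ?thesis by (simp add: Ascale)
  qed
  \<comment> \<open>The function on [0, s] is the difference of \<open>H\<close> along two opposite
    sides of the parallelogram, t -> H (x + s u + t v) - H (x + t v).\<close>
  have "\<exists>b\<in>{0<..<s}.
      (H ((x + s *\<^sub>R u) + s *\<^sub>R v) - H (x + s *\<^sub>R v)) - (H ((x + s *\<^sub>R u) + 0 *\<^sub>R v) - H (x + 0 *\<^sub>R v))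
      = (s - 0) * A ((x + s *\<^sub>R u) + b *\<^sub>R v) v - (s - 0) * A (x + b *\<^sub>R v) v"
    by (rule mvt_simple[OF s])
      (intro has_derivative_diff has_derivative_at_withinI[OF dH])
  then obtain b where b: "0 < b" "b < s" and
    eq1: "H (x + s *\<^sub>R u + s *\<^sub>R v) - H (x + s *\<^sub>R u) - H (x + s *\<^sub>R v) + H x
      = s * (A (x + b *\<^sub>R v + s *\<^sub>R u) v - A (x + b *\<^sub>R v) v)"
    by (auto simp: algebra_simps)
  have dA: "((\<lambda>t. A (x + b *\<^sub>R v + t *\<^sub>R u) v) has_derivative
      (\<lambda>h. h * D (x + b *\<^sub>R v + t *\<^sub>R u) u v)) (at t)" for t
  proof -
    have "((\<lambda>t. A (x + b *\<^sub>R v + t *\<^sub>R u) v) has_derivative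
        (\<lambda>h. D (x + b *\<^sub>R v + t *\<^sub>R u) (h *\<^sub>R u) v)) (at t)"
      by (rule has_derivative_compose[OF _ A]) (auto intro!: derivative_eq_intros)
    then show ?thesis by (simp add: Dscale)
  qed
  have "\<exists>a\<in>{0<..<s}. A (x + b *\<^sub>R v + s *\<^sub>R u) v - A (x + b *\<^sub>R v + 0 *\<^sub>R u) v
      = (s - 0) * D (x + b *\<^sub>R v + a *\<^sub>R u) u v"
    by (rule mvt_simple[OF s]) (rule has_derivative_at_withinI[OF dA])
  then obtain a where a: "0 < a" "a < s"
    and "A (x + b *\<^sub>R v + s *\<^sub>R u) v - A (x + b *\<^sub>R v) v = s * D (x + a *\<^sub>R u + b *\<^sub>R v) u v"
    by (auto simp: add_ac)
  with eq1 show ?thesis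
    by (intro that[OF a b]) (simp add: mult.assoc)
qed

text \<open>Exchanging \<open>u\<close> and \<open>v\<close> leaves the second difference unchanged,
  so values of \<open>D\<close> in the two orders agree at points of arbitrarily small
  parallelograms at \<open>x\<close>; continuity carries this to \<open>x\<close>.\<close>

lemma second_derivative_symmetric:
  fixes H :: "'a::real_normed_vector \<Rightarrow> real"
  assumes H: "\<And>x. (H has_derivative A x) (at x)"
    and A: "\<And>x v. ((\<lambda>x. A x v) has_derivative (\<lambda>u. D x u v)) (at x)"
    and cont: "\<And>u v. continuous_on UNIV (\<lambda>x. D x u v)"
  shows "D x u v = D x v u"
proof (rule ccontr)
  assume "D x u v \<noteq> D x v u"
  \<comment> \<open>Half the supposed gap: no number lies within \<open>e\<close> of both
    values.\<close>
  define e where "e = dist (D x u v) (D x v u) / 2"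
  have e: "e > 0" using \<open>D x u v \<noteq> D x v u\<close> by (simp add: e_def)
  have near: "\<exists>d>0. \<forall>y. dist y x < d \<longrightarrow> dist (D y u v) (D x u v) < e" for u v
    using cont[of u v] e unfolding continuous_on_iff by blast
  obtain d where d: "d > 0" "\<And>y. dist y x < d \<Longrightarrow> dist (D y u v) (D x u v) < e"
    using near by blast
  obtain d' where d': "d' > 0" "\<And>y. dist y x < d' \<Longrightarrow> dist (D y v u) (D x v u) < e"
    using near by blast
  \<comment> \<open>Small enough that the sampled points lie in both balls around \<open>x\<close>;
    the summand 1 keeps the denominator positive when both vectors vanish.\<close>
  define s where "s = min d d' / (norm u + norm v + 1)"
  have N: "norm u + norm v + 1 > 0"
    by (simp add: add_nonneg_pos)
  have s: "s > 0" using d d' N by (simp add: s_def)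
  have close: "dist (x + a *\<^sub>R u + b *\<^sub>R v) x < min d d'"
    if "0 < a" "a < s" "0 < b" "b < s" for a b
  proof -
    have "dist (x + a *\<^sub>R u + b *\<^sub>R v) x = norm (a *\<^sub>R u + b *\<^sub>R v)"
      by (simp add: dist_norm)
    also have "\<dots> \<le> a * norm u + b * norm v"
      using norm_triangle_ineq[of "a *\<^sub>R u" "b *\<^sub>R v"] that by simp
    also have "\<dots> \<le> s * norm u + s * norm v"
      using that by (intro add_mono mult_right_mono) auto
    also have "\<dots> < s * (norm u + norm v + 1)"
      using s by (simp add: algebra_simps)
    also have "\<dots> = min d d'" using N by (simp add: s_def)
    finally show ?thesis .
  qed
  obtain a b where ab: "0 < a" "a < s" "0 < b" "b < s"
    "H (x + s *\<^sub>R u + s *\<^sub>R v) - H (x + s *\<^sub>R u) - H (x + s *\<^sub>R v) + H x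
      = s * s * D (x + a *\<^sub>R u + b *\<^sub>R v) u v"
    using second_difference_mvt[OF H A s] by blast
  obtain a' b' where ab': "0 < a'" "a' < s" "0 < b'" "b' < s"
    "H (x + s *\<^sub>R v + s *\<^sub>R u) - H (x + s *\<^sub>R v) - H (x + s *\<^sub>R u) + H x
      = s * s * D (x + a' *\<^sub>R v + b' *\<^sub>R u) v u"
    using second_difference_mvt[OF H A s] by blast
  have swap: "x + s *\<^sub>R v + s *\<^sub>R u = x + s *\<^sub>R u + s *\<^sub>R v"
    "x + a' *\<^sub>R v + b' *\<^sub>R u = x + b' *\<^sub>R u + a' *\<^sub>R v" by (simp_all add: add_ac)
  have "s * s * D (x + a *\<^sub>R u + b *\<^sub>R v) u v = s * s * D (x + b' *\<^sub>R u + a' *\<^sub>R v) v u"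
    using ab(5) ab'(5) unfolding swap by linarith
  then have "D (x + a *\<^sub>R u + b *\<^sub>R v) u v = D (x + b' *\<^sub>R u + a' *\<^sub>R v) v u"
    using s by simp
  moreover have "dist (D (x + a *\<^sub>R u + b *\<^sub>R v) u v) (D x u v) < e"
    using close[OF ab(1-4)] by (intro d(2)) simp
  \<comment> \<open>After the exchange \<open>b'\<close> is the coefficient of \<open>u\<close> and
    \<open>a'\<close> that of \<open>v\<close>, hence the reordered bounds.\<close>
  moreover have "dist (D (x + b' *\<^sub>R u + a' *\<^sub>R v) v u) (D x v u) < e"
    using close[OF ab'(3,4,1,2)] by (intro d'(2)) simp
  ultimately show False
    unfolding e_def by (metis dist_triangle_half_r less_irrefl)
qed

section \<open>The Poincare lemma for 1-forms\<close>

text \<open>Differentiating under the integral in direction h gives the integrand A (t x) h + t D (t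
  x) h x. By symmetry of \<open>D\<close> this is the t-derivative of t A (t x) h, so it integrates
  to A x h.\<close>

lemma closed_one_form_potential:
  fixes A :: "'a::euclidean_space \<Rightarrow> 'a \<Rightarrow> real"
  assumes lin: "\<And>x. linear (A x)"
    and A: "\<And>x v. ((\<lambda>x. A x v) has_derivative (\<lambda>u. D x u v)) (at x)"
    and cont: "\<And>u v. continuous_on UNIV (\<lambda>x. D x u v)"
    and sym: "\<And>x u v. D x u v = D x v u"
  shows "((\<lambda>x. integral {0..1} (\<lambda>t. A (t *\<^sub>R x) x)) has_derivative A x) (at x)"
proof -
  have linD1: "linear (\<lambda>u. D x u v)" for x v
    using has_derivative_linear[OF A] .
  have linD2: "linear (D x u)" for x u
    using linD1[of x u] sym[of x _ u] by simp
  \<comment> \<open>Regularity of \<open>A\<close> and \<open>D\<close> is known only for fixed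
    vector arguments, while the integrand has \<open>x\<close> in both slots. Expanding the second
    slot in the basis separates the two dependences.\<close>
  have repA: "A y x = (\<Sum>i\<in>Basis. (x \<bullet> i) * A y i)" for x y
    using linear_sum[OF lin, of y "\<lambda>i. (x \<bullet> i) *\<^sub>R i" Basis]
    by (simp add: euclidean_representation linear_cmul[OF lin])
  have repD: "D y u x = (\<Sum>i\<in>Basis. (x \<bullet> i) * D y u i)" for x y u
    using linear_sum[OF linD2, of y u "\<lambda>i. (x \<bullet> i) *\<^sub>R i" Basis]
    by (simp add: euclidean_representation linear_cmul[OF linD2])
  have contA: "continuous_on UNIV (\<lambda>x. A x v)" for v
    using has_derivative_continuous[OF A] by (simp add: continuous_on_eq_continuous_within)
  \<comment> \<open>The product-rule differential of x -> A (t x) x, packaged as a bounded linear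
    map because \<open>leibniz_rule\<close> integrates operator-valued derivatives.\<close>
  define F where "F x t = Blinfun (\<lambda>h. A (t *\<^sub>R x) h + t * D (t *\<^sub>R x) h x)" for x and t :: real
  have F: "blinfun_apply (F x t) = (\<lambda>h. A (t *\<^sub>R x) h + t * D (t *\<^sub>R x) h x)" for x t
    unfolding F_def
  proof (rule bounded_linear_Blinfun_apply)
    show "bounded_linear (\<lambda>h. A (t *\<^sub>R x) h + t * D (t *\<^sub>R x) h x)"
      using linear_compose_scale_right[OF linD1]
      by (intro linear_conv_bounded_linear[THEN iffD1] linear_compose_add lin) simp
  qed
  have deriv: "((\<lambda>x. A (t *\<^sub>R x) x) has_derivative blinfun_apply (F x t)) (at x)" for x t
  proof -
    have "((\<lambda>x. A (t *\<^sub>R x) i) has_derivative (\<lambda>h. D (t *\<^sub>R x) (t *\<^sub>R h) i)) (at x)" for i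
      by (rule has_derivative_compose[OF _ A]) (auto intro!: derivative_eq_intros)
    then have dA: "((\<lambda>x. A (t *\<^sub>R x) i) has_derivative (\<lambda>h. t * D (t *\<^sub>R x) h i)) (at x)" for i
      using linear_cmul[OF linD1] by simp
    have "((\<lambda>x. \<Sum>i\<in>Basis. (x \<bullet> i) * A (t *\<^sub>R x) i) has_derivative
        (\<lambda>h. \<Sum>i\<in>Basis. (x \<bullet> i) * (t * D (t *\<^sub>R x) h i) + (h \<bullet> i) * A (t *\<^sub>R x) i)) (at x)"
      by (intro has_derivative_sum has_derivative_mult dA has_derivative_inner_left
          has_derivative_ident)
    moreover have "(\<lambda>h. \<Sum>i\<in>Basis. (x \<bullet> i) * (t * D (t *\<^sub>R x) h i) + (h \<bullet> i) * A (t *\<^sub>R x) i)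
        = blinfun_apply (F x t)"
      unfolding F by (subst repA, subst repD)
        (simp add: sum.distrib sum_distrib_left mult_ac add.commute)
    ultimately show ?thesis
      by (subst repA) simp
  qed
  have contF: "continuous_on (UNIV \<times> cbox 0 1) (\<lambda>(x, t). F x t)"
    unfolding split_beta
  \<comment> \<open>In finite dimension, continuity of an operator-valued map can be tested on basis
    vectors.\<close>
  proof (rule continuous_on_blinfun_componentwise)
    fix i :: 'a
    have "continuous_on (UNIV \<times> cbox 0 1)
        (\<lambda>p. A (snd p *\<^sub>R fst p) i + snd p * (\<Sum>j\<in>Basis. (fst p \<bullet> j) * D (snd p *\<^sub>R fst p) i j))"
      by (intro continuous_intros continuous_on_compose2[OF contA] continuous_on_compose2[OF cont])
        auto
    then show "continuous_on (UNIV \<times> cbox 0 1) (\<lambda>p. blinfun_apply (F (fst p) (snd p)) i)"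
      unfolding F by (subst repD)
  qed
  have contAt: "continuous_on (cbox 0 1) (\<lambda>t. A (t *\<^sub>R x) x)" for x
    by (intro continuous_on_compose2[OF contA] continuous_intros) auto
  have "((\<lambda>x. integral (cbox 0 1) (\<lambda>t. A (t *\<^sub>R x) x)) has_derivative
      blinfun_apply (integral (cbox 0 1) (F x))) (at x)"
    by (intro leibniz_rule[where U = UNIV] deriv integrable_continuous contAt contF) auto
  moreover have "blinfun_apply (integral (cbox 0 1) (F x)) = A x"
  proof
    fix h
    have "continuous_on (cbox 0 1) (F x)"
      using continuous_on_compose2[OF contF, of "cbox 0 1" "Pair x"]
      by (auto simp: continuous_on_Pair)
    then have "F x integrable_on cbox 0 1"
      by (rule integrable_continuous)
    \<comment> \<open>Evaluation at \<open>h\<close> is bounded linear, so it commutes with the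
      integral.\<close>
    then have "((\<lambda>t. blinfun_apply (F x t) h) has_integral
        blinfun_apply (integral (cbox 0 1) (F x)) h) {0..1}"
      using has_integral_linear[OF integrable_integral blinfun.bounded_linear_left]
      by (fastforce simp: o_def)
    \<comment> \<open>Closedness enters here: \<open>sym\<close> makes the integrand the exact
      derivative of t A (t x) h.\<close>
    moreover have "((\<lambda>t. blinfun_apply (F x t) h) has_integral
        1 * A (1 *\<^sub>R x) h - 0 * A (0 *\<^sub>R x) h) {0..1}"
    proof (rule fundamental_theorem_of_calculus)
      fix t :: real
      have "((\<lambda>t. A (t *\<^sub>R x) h) has_derivative (\<lambda>s. D (t *\<^sub>R x) (s *\<^sub>R x) h)) (at t)"
        by (rule has_derivative_compose[OF _ A]) (auto intro!: derivative_eq_intros)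
      then have "((\<lambda>t. A (t *\<^sub>R x) h) has_real_derivative D (t *\<^sub>R x) x h) (at t)"
        unfolding has_field_derivative_def using linear_cmul[OF linD1]
        by (simp add: mult.commute[of _ "D _ _ _"])
      then have "((\<lambda>t. t * A (t *\<^sub>R x) h) has_real_derivative blinfun_apply (F x t) h) (at t)"
        by (auto intro!: derivative_eq_intros simp: F sym[of _ x h])
      then show "((\<lambda>t. t * A (t *\<^sub>R x) h) has_vector_derivative blinfun_apply (F x t) h)
          (at t within {0..1})"
        by (rule has_vector_derivative_at_within[OF
            has_real_derivative_iff_has_vector_derivative[THEN iffD1]])
    qed simp
    ultimately have "blinfun_apply (integral (cbox 0 1) (F x)) h
        = 1 * A (1 *\<^sub>R x) h - 0 * A (0 *\<^sub>R x) h"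
      by (rule has_integral_unique)
    then show "blinfun_apply (integral (cbox 0 1) (F x)) h = A x h" by simp
  qed
  ultimately show ?thesis
    by (simp add: cbox_interval)
qed

section \<open>Derivatives of polynomials\<close>

text \<open>Structural induction with the sum and product rules. That directional derivatives are
  again polynomial in the base point gives the continuity of \<open>D\<close> in the theorem and
  lets the smoothness proof iterate.\<close>

lemma real_polynomial_function_has_derivative:
  assumes "real_polynomial_function p"
  shows "\<exists>D. (\<forall>x. (p has_derivative D x) (at x)) \<and> (\<forall>v. real_polynomial_function (\<lambda>x. D x v))"
  using assms
proof induction
  case (linear f)
  then show ?case
    by (intro exI[of _ "\<lambda>x. f"]) (auto intro: bounded_linear_imp_has_derivative)
next
  case (const c)
  show ?case
    by (intro exI[of _ "\<lambda>x v. 0"]) auto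
next
  case (add f g)
  then obtain D E where
    "\<And>x. (f has_derivative D x) (at x)" "\<And>v. real_polynomial_function (\<lambda>x. D x v)"
    "\<And>x. (g has_derivative E x) (at x)" "\<And>v. real_polynomial_function (\<lambda>x. E x v)"
    by blast
  then show ?case
    by (intro exI[of _ "\<lambda>x v. D x v + E x v"]) (auto intro: has_derivative_add)
next
  case (mult f g)
  then obtain D E where
    "\<And>x. (f has_derivative D x) (at x)" "\<And>v. real_polynomial_function (\<lambda>x. D x v)"
    "\<And>x. (g has_derivative E x) (at x)" "\<And>v. real_polynomial_function (\<lambda>x. E x v)"
    by blast
  with mult.hyps show ?case
    by (intro exI[of _ "\<lambda>x v. f x * E x v + D x v * g x"] conjI allI has_derivative_mult
        real_polynomial_function.intros(3) real_polynomial_function.intros(4))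
qed

lemma real_polynomial_function_C_class:
  assumes "real_polynomial_function p"
  shows "C_class k p"
  using assms
proof (induction k arbitrary: p)
  case 0
  then show ?case
    by (simp add: continuous_on_polymonial_function real_polynomial_function_eq)
next
  case (Suc k)
  obtain D where D: "\<And>x. (p has_derivative D x) (at x)"
    "\<And>v. real_polynomial_function (\<lambda>x. D x v)"
    using real_polynomial_function_has_derivative[OF Suc.prems] by blast
  have "frechet_derivative p (at x) = D x" for x
    using frechet_derivative_at[OF D(1)] by simp
  with D Suc.IH show ?case
    by (auto simp: differentiable_def)
qed

section \<open>Coordinates and matrices\<close>

lemma linear_coords:
  assumes "indexed_basis b"
  shows "linear (coords b)"
  using assms
  by (intro linearI)
    (auto simp: coords_def vec_eq_iff indexed_basis_def real_vector.representation_add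
      real_vector.representation_scale)

text \<open>Frees the matrix condition from the basis: the (i, j) entries of the two products are
  \<omega> (f (b i)) (b j) and \<omega> (b i) (f (b j)), and a bilinear map vanishing on pairs of
  basis vectors is zero.\<close>

lemma endo_matrix_in_sp_matrices_iff:
  fixes b :: "'m::finite \<Rightarrow> 'v::euclidean_space"
  assumes b: "indexed_basis b" and \<omega>: "bilinear \<omega>" and f: "linear f"
  shows "endo_matrix b f \<in> sp_matrices b \<omega> \<longleftrightarrow> (\<forall>u v. \<omega> (f u) v + \<omega> u (f v) = 0)"
proof -
  have expand: "f (b j) = (\<Sum>k\<in>UNIV. (coords b (f (b j)) $ k) *\<^sub>R b k)" for j
    by (simp add: coords_expansion[OF b])
  have l: "linear (\<lambda>u. \<omega> u v)" and r: "linear (\<omega> u)" for u v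
    using \<omega> by (auto simp: bilinear_def)
  have right: "(form_matrix b \<omega> ** endo_matrix b f) $ i $ j = \<omega> (b i) (f (b j))" for i j
    by (subst expand) (simp add: linear_sum[OF r] linear_cmul[OF r] matrix_matrix_mult_def
        form_matrix_def endo_matrix_def mult.commute)
  have left: "(transpose (endo_matrix b f) ** form_matrix b \<omega>) $ i $ j = \<omega> (f (b i)) (b j)" for i j
    by (subst expand) (simp add: linear_sum[OF l] linear_cmul[OF l] matrix_matrix_mult_def
        form_matrix_def endo_matrix_def transpose_def)
  have "endo_matrix b f \<in> sp_matrices b \<omega> \<longleftrightarrow>
      (\<forall>i j. \<omega> (f (b i)) (b j) + \<omega> (b i) (f (b j)) = 0)"
    by (simp add: sp_matrices_def vec_eq_iff left right)
  also have "\<dots> \<longleftrightarrow> (\<forall>u v. \<omega> (f u) v + \<omega> u (f v) = 0)"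
  proof
    assume basis: "\<forall>i j. \<omega> (f (b i)) (b j) + \<omega> (b i) (f (b j)) = 0"
    have sum: "bilinear (\<lambda>u v. \<omega> (f u) v + \<omega> u (f v))"
      unfolding bilinear_def using linear_compose[OF f l] linear_compose[OF f r] l r
      by (auto intro!: linear_compose_add simp: o_def)
    have zero: "bilinear (\<lambda>u v :: 'v. 0 :: real)"
      by (simp add: bilinear_def linear_zero)
    have span: "UNIV \<subseteq> span (range b)"
      using b by (simp add: indexed_basis_def)
    have "\<omega> (f u) v + \<omega> u (f v) = 0" for u v
      by (rule bilinear_eq[OF sum zero span span]) (use basis in auto)
    then show "\<forall>u v. \<omega> (f u) v + \<omega> u (f v) = 0"
      by blast
  qed simp
  finally show ?thesis .
qed

section \<open>Hamiltonian fields and closed 1-forms\<close>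

theorem theorem4p11:
  fixes \<omega> :: "'v::euclidean_space \<Rightarrow> 'v \<Rightarrow> real"
    and b :: "'m::finite \<Rightarrow> 'v"
    and X :: "'v \<Rightarrow> 'v"
    and n :: nat
  assumes "DIM('v) = 2 * n"
    and "symplectic_form \<omega>"
    and "indexed_basis b"
    and "polynomial_map b X"
    and "X 0 = 0"
  shows "hamiltonian_vector_field \<omega> X \<longleftrightarrow>
    (\<forall>x. endo_matrix b (frechet_derivative X (at x)) \<in> sp_matrices b \<omega>)"
proof -
  have \<omega>: "bilinear \<omega>" and alt: "\<And>v. \<omega> v v = 0"
    using assms(2) by (auto simp: symplectic_form_def)
  have l: "linear (\<lambda>u. \<omega> u v)" and r: "linear (\<omega> u)" for u v
    using \<omega> by (auto simp: bilinear_def)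
  have anti: "\<omega> u v = - \<omega> v u" for u v
    using alt[of "u + v"] alt[of u] alt[of v]
    by (simp add: bilinear_ladd[OF \<omega>] bilinear_radd[OF \<omega>])
  \<comment> \<open>Composing with the linear map \<open>coords b\<close> moves polynomiality from
    coordinate columns to the space itself.\<close>
  have poly_coord: "real_polynomial_function (\<lambda>x. coords b (X x) $ i)" for i
  proof -
    obtain P where P: "real_polynomial_function P" "\<And>x. coords b (X x) $ i = P (coords b x)"
      using assms(4) unfolding polynomial_map_def by blast
    have "polynomial_function (coords b)"
      using linear_coords[OF assms(3)]
      by (intro polynomial_function_bounded_linear) (simp add: linear_conv_bounded_linear)
    then have "real_polynomial_function (P \<circ> coords b)"
      using P(1) by (rule real_polynomial_function_compose)
    then show ?thesis by (simp add: P(2) o_def)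
  qed
  have X: "X x = (\<Sum>i\<in>UNIV. (coords b (X x) $ i) *\<^sub>R b i)" for x
    by (simp add: coords_expansion[OF assms(3)])
  have "\<exists>D. (\<forall>x. ((\<lambda>x. coords b (X x) $ i) has_derivative D x) (at x))
      \<and> (\<forall>v. real_polynomial_function (\<lambda>x. D x v))" for i
    using real_polynomial_function_has_derivative[OF poly_coord] .
  then obtain E where E: "\<And>i x. ((\<lambda>x. coords b (X x) $ i) has_derivative E i x) (at x)"
    "\<And>i v. real_polynomial_function (\<lambda>x. E i x v)"
    by metis
  \<comment> \<open>The derivative of \<open>X\<close>, assembled from the differentials of its
    components so that its polynomial dependence on \<open>x\<close> stays visible.\<close>
  define X' where "X' x u = (\<Sum>i\<in>UNIV. E i x u *\<^sub>R b i)" for x u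
  have dX: "(X has_derivative X' x) (at x)" for x
    unfolding X'_def
    by (subst ext[OF X]) (intro has_derivative_sum has_derivative_scaleR_left E(1))
  define A where "A x = \<omega> (X x)" for x
  define D where "D x u v = \<omega> (X' x u) v" for x u v
  have poly_A: "real_polynomial_function (\<lambda>x. A x v)" for v
    unfolding A_def
    by (subst X, simp add: linear_sum[OF l] linear_cmul[OF l])
      (intro real_polynomial_function_sum real_polynomial_function.intros(4)
        real_polynomial_function.intros(2) poly_coord finite)
  have "real_polynomial_function (\<lambda>x. D x u v)" for u v
    unfolding D_def X'_def
    by (simp add: linear_sum[OF l] linear_cmul[OF l])
      (intro real_polynomial_function_sum real_polynomial_function.intros(4)
        real_polynomial_function.intros(2) E(2) finite)
  then have contD: "continuous_on UNIV (\<lambda>x. D x u v)" for u v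
    by (simp add: continuous_on_polymonial_function real_polynomial_function_eq)
  have dA: "((\<lambda>x. A x v) has_derivative (\<lambda>u. D x u v)) (at x)" for x v
    unfolding A_def D_def
    using l by (intro bounded_linear.has_derivative[OF _ dX]) (simp add: linear_conv_bounded_linear)
  \<comment> \<open>Antisymmetry turns \<omega> (X' x u) v + \<omega> u (X' x v) into D x u v - D x
    v u.\<close>
  have "(endo_matrix b (frechet_derivative X (at x)) \<in> sp_matrices b \<omega>) \<longleftrightarrow>
      (\<forall>u v. D x u v = D x v u)" for x
    using endo_matrix_in_sp_matrices_iff[OF assms(3) \<omega> has_derivative_linear[OF dX[of x]]]
      frechet_derivative_at[OF dX[of x]] anti[of _ "X' x _"]
    by (simp add: D_def)
  moreover have "hamiltonian_vector_field \<omega> X \<longleftrightarrow> (\<forall>x u v. D x u v = D x v u)"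
  proof
    assume "hamiltonian_vector_field \<omega> X"
    then obtain H where "\<And>x. (H has_derivative A x) (at x)"
      by (auto simp: hamiltonian_vector_field_def A_def)
    then show "\<forall>x u v. D x u v = D x v u"
      using second_derivative_symmetric[of H A, OF _ dA contD] by blast
  next
    assume sym: "\<forall>x u v. D x u v = D x v u"
    define H where "H x = integral {0..1} (\<lambda>t. A (t *\<^sub>R x) x)" for x
    have H: "(H has_derivative A x) (at x)" for x
      unfolding H_def using r sym
      by (intro closed_one_form_potential[OF _ dA contD]) (auto simp: A_def)
    then have "frechet_derivative H (at x) = A x" for x
      using frechet_derivative_at[OF H] by simp
    moreover have "continuous_on UNIV H"
      using has_derivative_continuous[OF H] by (simp add: continuous_on_eq_continuous_within)
    \<comment> \<open>Order 0 is continuity of \<open>H\<close>; any higher order reduces to the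
      polynomials x -> A x v, the directional derivatives of \<open>H\<close>.\<close>
    ultimately have "C_class k H" for k
      using H by (cases k) (auto simp: differentiable_def real_polynomial_function_C_class[OF poly_A])
    then show "hamiltonian_vector_field \<omega> X"
      using H by (auto simp: hamiltonian_vector_field_def smooth_def A_def)
  qed
  ultimately show ?thesis by simp
qed

end
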